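(* For each integer $n\ge 0$, \[ \sum_{k=0}^n \frac{\binom{2k}{k}\binom{2(n-k)}{n-k}}{(2k+1)(2(n-k)+1)}=\frac{16^n}{(n+1)(2n+1)\binom{2n}{n}}. \] *)

theory Defs
  imports Complex_Main
begin

end

theory Submission
  imports Defs "HOL-Computational_Algebra.Formal_Power_Series"
begin

unbundle fps_syntax

text \<open>
  Let \<open>B = \<Sum> (2k choose k) X^k\<close> and \<open>A = \<Sum> (2k choose k) / (2k+1) X^k\<close>, so that the sum
  is the \<open>n\<close>-th coefficient of \<open>A\<^sup>2\<close>. From \<open>2XA' + A = B\<close> we get \<open>X(A\<^sup>2)' + A\<^sup>2 = AB\<close>, so
  the \<open>n\<close>-th coefficient of \<open>AB\<close> is \<open>n + 1\<close> times the sum. From \<open>(1 - 4X)B' = 2B\<close>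
  and \<open>(1 - 4X)B\<^sup>2 = 1\<close> we get \<open>2X(1 - 4X)(AB)' = 1 - AB + 8X AB\<close>, which is the first-order recurrence
  \<open>(2n + 3) p(n+1) = 8 (n+1) p(n)\<close> for the coefficients of \<open>AB\<close>.
\<close>

text \<open>Both sides agree after multiplication by \<open>fact n * fact n * (real n + 1)\<close>:
  the extra factor \<open>n + 1\<close> completes the square of \<open>fact (Suc n)\<close>, so
  \<open>double\<close> applies at \<open>Suc n\<close>, and then at \<open>n\<close>.\<close>

lemma central_binomial_Suc:
  "(real n + 1) * real ((2 * Suc n) choose Suc n) = 2 * (2 * real n + 1) * real ((2 * n) choose n)"
proof -
  have double: "fact m * fact m * real ((2 * m) choose m) = fact (2 * m)" for m
    using binomial_fact_lemma[of m "2 * m"]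
    by (metis add_diff_cancel_right' le_add2 mult_2 of_nat_fact of_nat_mult)
  have "(fact n * fact n * (real n + 1)) * ((real n + 1) * real ((2 * Suc n) choose Suc n))
      = fact (Suc n) * fact (Suc n) * real ((2 * Suc n) choose Suc n)"
    by (simp only: fact_Suc of_nat_Suc) (simp only: ac_simps)
  also have "\<dots> = (real n + 1) * (2 * (2 * real n + 1)) * fact (2 * n)"
    unfolding double by (simp add: algebra_simps)
  also have "\<dots> = (fact n * fact n * (real n + 1)) * (2 * (2 * real n + 1) * real ((2 * n) choose n))"
    unfolding double[symmetric] by (simp only: ac_simps)
  finally show ?thesis
    by (simp add: add_eq_0_iff_both_eq_0)
qed

definition central_binomial_fps :: "real fps" where
  "central_binomial_fps = Abs_fps (\<lambda>k. real ((2 * k) choose k))"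

definition central_binomial_odd_fps :: "real fps" where
  "central_binomial_odd_fps = Abs_fps (\<lambda>k. real ((2 * k) choose k) / (2 * real k + 1))"

text \<open>Coefficientwise this is the recurrence \<open>central_binomial_Suc\<close>.\<close>

lemma central_binomial_fps_ode:
  "(1 - 4 * fps_X) * fps_deriv central_binomial_fps = 2 * central_binomial_fps"
proof (rule fps_ext)
  fix n
  show "((1 - 4 * fps_X) * fps_deriv central_binomial_fps) $ n = (2 * central_binomial_fps) $ n"
    using central_binomial_Suc[of n]
    by (cases n)
      (simp_all add: central_binomial_fps_def algebra_simps numeral_fps_const)
qed

text \<open>By the differential equation the left side has derivative zero, so it equals its
  constant coefficient.\<close>

lemma central_binomial_fps_square:
  "(1 - 4 * fps_X) * central_binomial_fps\<^sup>2 = 1"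
proof -
  let ?B = central_binomial_fps
  have "fps_deriv ((1 - 4 * fps_X) * ?B\<^sup>2)
      = 2 * ?B * ((1 - 4 * fps_X) * fps_deriv ?B) - 4 * ?B\<^sup>2"
    by (simp add: power2_eq_square algebra_simps)
  also have "\<dots> = 0"
    by (simp add: central_binomial_fps_ode power2_eq_square)
  finally have "(1 - 4 * fps_X) * ?B\<^sup>2 = fps_const (((1 - 4 * fps_X) * ?B\<^sup>2) $ 0)"
    by (simp only: fps_deriv_eq_0_iff)
  also have "((1 - 4 * fps_X) * ?B\<^sup>2) $ 0 = 1"
    by (simp add: central_binomial_fps_def power2_eq_square)
  finally show ?thesis by simp
qed

text \<open>Coefficientwise this is 2n/(2n+1) = 1 - 1/(2n+1).\<close>

lemma central_binomial_odd_fps_ode: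
  "2 * fps_X * fps_deriv central_binomial_odd_fps = central_binomial_fps - central_binomial_odd_fps"
proof (rule fps_ext)
  fix n
  have "2 * real n + 1 \<noteq> 0"
    by linarith
  then show "(2 * fps_X * fps_deriv central_binomial_odd_fps) $ n
      = (central_binomial_fps - central_binomial_odd_fps) $ n"
    by (cases n)
      (simp_all add: central_binomial_fps_def central_binomial_odd_fps_def numeral_fps_const
        mult.assoc divide_simps, simp_all add: algebra_simps)
qed

lemma central_binomial_product_fps_ode:
  defines "P \<equiv> central_binomial_odd_fps * central_binomial_fps"
  shows "2 * fps_X * (1 - 4 * fps_X) * fps_deriv P = 1 - P + 8 * fps_X * P"
proof -
  let ?A = central_binomial_odd_fps and ?B = central_binomial_fps
  \<comment> \<open>The product rule, grouped so that each derivative carries exactly the factor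
    with which its own differential equation eliminates it.\<close>
  have "2 * fps_X * (1 - 4 * fps_X) * fps_deriv P
      = (1 - 4 * fps_X) * ?B * (2 * fps_X * fps_deriv ?A)
        + 2 * fps_X * ?A * ((1 - 4 * fps_X) * fps_deriv ?B)"
    by (simp add: P_def algebra_simps)
  also have "\<dots> = (1 - 4 * fps_X) * ?B\<^sup>2 - P + 8 * fps_X * P"
    unfolding central_binomial_odd_fps_ode central_binomial_fps_ode
    by (simp add: P_def power2_eq_square algebra_simps)
  finally show ?thesis
    by (simp add: central_binomial_fps_square)
qed

lemma central_binomial_product_fps_nth:
  "(central_binomial_odd_fps * central_binomial_fps) $ n
    = 16 ^ n / ((2 * real n + 1) * real ((2 * n) choose n))"
proof (induction n)
  case 0
  show ?case
    by (simp add: central_binomial_odd_fps_def central_binomial_fps_def)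
next
  case (Suc n)
  define P where "P = central_binomial_odd_fps * central_binomial_fps"
  have "(2 * fps_X * (1 - 4 * fps_X) * fps_deriv P) $ Suc n = (1 - P + 8 * fps_X * P) $ Suc n"
    using central_binomial_product_fps_ode by (simp add: P_def)
  \<comment> \<open>The left coefficient is 2(n+1) p(n+1) - 8n p(n), the right one 8 p(n) - p(n+1).
    The case split serves the X^2 P' term, which vanishes here for n = 0.\<close>
  then have rec: "(2 * real n + 3) * P $ Suc n = 8 * (real n + 1) * P $ n"
    by (cases n) (simp_all add: numeral_fps_const mult.assoc algebra_simps)
  have pos: "real ((2 * n) choose n) > 0" "real ((2 * Suc n) choose Suc n) > 0"
    by (simp_all only: of_nat_0_less_iff zero_less_binomial_iff) simp_all
  \<comment> \<open>With the binomial factor attached, \<open>central_binomial_Suc\<close> absorbs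
    \<open>n + 1\<close>: the quantity (2n+1) (2n choose n) p(n) is multiplied by 16 at each
    step.\<close>
  have "(2 * real n + 3) * (real ((2 * Suc n) choose Suc n) * P $ Suc n)
      = 8 * ((real n + 1) * real ((2 * Suc n) choose Suc n)) * P $ n"
    by (simp only: mult.left_commute[of "2 * real n + 3"] rec) (simp only: ac_simps)
  also have "\<dots> = 16 * ((2 * real n + 1) * real ((2 * n) choose n) * P $ n)"
    by (simp only: central_binomial_Suc)
  also have "(2 * real n + 1) * real ((2 * n) choose n) * P $ n = 16 ^ n"
    using Suc.IH pos by (simp add: P_def)
  finally have "(2 * real n + 3) * real ((2 * Suc n) choose Suc n) * P $ Suc n = 16 ^ Suc n"
    by (simp only: power_Suc mult.assoc)
  moreover have "2 * real (Suc n) + 1 = 2 * real n + 3"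
    by simp
  moreover have "(2 * real n + 3) * real ((2 * Suc n) choose Suc n) \<noteq> 0"
    using pos(2) by (simp only: mult_eq_0_iff) linarith
  ultimately show ?case
    unfolding P_def[symmetric] by (metis mult.commute nonzero_eq_divide_eq)
qed

theorem theorem8:
  fixes n :: nat
  shows "(\<Sum>k=0..n. (real ((2 * k) choose k) * real ((2 * (n - k)) choose (n - k))) /
            ((2 * real k + 1) * (2 * real (n - k) + 1)))
         = 16 ^ n / ((real n + 1) * (2 * real n + 1) * real ((2 * n) choose n))"
proof -
  let ?A = central_binomial_odd_fps and ?B = central_binomial_fps
  \<comment> \<open>Since A (B - A) + A^2 = AB, the differential equation for A turns the bracket on
    the right into AB.\<close>
  have "2 * (fps_X * fps_deriv (?A\<^sup>2) + ?A\<^sup>2) = 2 * (?A * (2 * fps_X * fps_deriv ?A) + ?A\<^sup>2)"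
    by (simp add: power2_eq_square algebra_simps)
  also have "\<dots> = 2 * (?A * ?B)"
    by (simp only: central_binomial_odd_fps_ode) (simp add: power2_eq_square algebra_simps)
  finally have "fps_X * fps_deriv (?A\<^sup>2) + ?A\<^sup>2 = ?A * ?B"
    by (simp only: mult_cancel_left) simp
  then have "(fps_X * fps_deriv (?A\<^sup>2) + ?A\<^sup>2) $ n = (?A * ?B) $ n"
    by simp
  \<comment> \<open>The operator F -> X F' + F multiplies the n-th coefficient by n + 1.\<close>
  then have "(real n + 1) * (?A\<^sup>2) $ n = 16 ^ n / ((2 * real n + 1) * real ((2 * n) choose n))"
    unfolding central_binomial_product_fps_nth by (cases n) (simp_all add: algebra_simps)
  then have "(?A\<^sup>2) $ n = 16 ^ n / ((real n + 1) * (2 * real n + 1) * real ((2 * n) choose n))"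
    by (simp add: eq_divide_eq ac_simps)
  then show ?thesis
    by (simp add: power2_eq_square fps_mult_nth central_binomial_odd_fps_def)
qed

end
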